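(* Let $(M,\vartheta,\omega)$ be a twisted contact manifold, i.e. a manifold $M$ of odd dimension $2n+1$ equipped with a $1$-form $\vartheta$ and a $2$-form $\omega$ such that $\vartheta\wedge(d\vartheta+\omega)^n\neq 0$ everywhere on $M$. Let $E$ be the vector field on $M$ defined by $i(E)\vartheta=1$ and $i(E)(d\vartheta+\omega)=0$, and let $\Lambda$ be the bivector field on $M$ whose associated morphism $\Lambda^{\#}$ is given, for all $1$-forms $\alpha$ on $M$, by $\Lambda^{\#}(\vartheta)=0$ and $i(\Lambda^{\#}(\alpha))(d\vartheta+\omega)=-(\alpha-\langle\alpha,E\rangle\vartheta)$. Then $((\Lambda,E),\omega)$ is a twisted Jacobi structure on $M$.
   Context: Everything is smooth. Conventions: for a bivector field $\Lambda$ on $M$, $\Lambda^{\#}:T^*M\to TM$ is defined by $\langle\beta,\Lambda^{\#}(\alpha)\rangle=\Lambda(\alpha,\beta)$. For a $k$-form $\eta$, $\Lambda^{\#}(\eta)$ is the $k$-vector field $\Lambda^{\#}(\eta)(\alpha_1,\dots,\alpha_k)=(-1)^k\eta(\Lambda^{\#}(\alpha_1),\dots,\Lambda^{\#}(\alpha_k))$, and for a vector field $X$, $(\Lambda^{\#}\otimes 1)(\eta)(X)$ is the $(k-1)$-vector field $(\Lambda^{\#}\otimes 1)(\eta)(X)(\alpha_1,\dots,\alpha_{k-1})=(-1)^k\eta(\Lambda^{\#}(\alpha_1),\dots,\Lambda^{\#}(\alpha_{k-1}),X)$. $[\cdot,\cdot]$ is the Schouten bracket of multivector fields, with $[X,P]=\mathcal{L}_XP$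 for a vector field $X$ and $[X_1\wedge X_2,Y_1\wedge Y_2]=\sum_{i,j}(-1)^{i+j}[X_i,Y_j]\wedge X_{3-i}\wedge Y_{3-j}$. $i(X)$ denotes interior product. Twisted Jacobi structure on $M$: a pair $((\Lambda,E),\omega)$ consisting of a bivector field $\Lambda$, a vector field $E$ and a $2$-form $\omega$ such that $$[\Lambda,\Lambda]+2E\wedge\Lambda=2\Lambda^{\#}(d\omega)+2(\Lambda^{\#}(\omega))\wedge E,$$ $$[E,\Lambda]=(\Lambda^{\#}\otimes 1)(d\omega)(E)-\big((\Lambda^{\#}\otimes 1)(\omega)(E)\big)\wedge E.$$ *)

theory Defs
  imports "HOL-Analysis.Analysis" "HOL-Combinatorics.Permutations"
begin

section \<open>Smooth maps and smooth manifolds\<close>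

(* Both notions are meant for open S only. *)
primrec Ck_on :: "nat \<Rightarrow> 'a::euclidean_space set \<Rightarrow> ('a \<Rightarrow> 'b::real_normed_vector) \<Rightarrow> bool" where
  "Ck_on 0 S f \<longleftrightarrow> continuous_on S f"
| "Ck_on (Suc k) S f \<longleftrightarrow>
     (\<forall>x\<in>S. f differentiable (at x)) \<and> (\<forall>v. Ck_on k S (\<lambda>x. frechet_derivative f (at x) v))"

definition smooth_on :: "'a::euclidean_space set \<Rightarrow> ('a \<Rightarrow> 'b::real_normed_vector) \<Rightarrow> bool" where
  "smooth_on S f \<longleftrightarrow> (\<forall>k. Ck_on k S f)"

type_synonym ('m, 'e) chart = "'m set \<times> ('m \<Rightarrow> 'e)"

definition chart_image :: "('m, 'e) chart \<Rightarrow> 'e set" where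
  "chart_image c = snd c ` fst c"

definition transition :: "('m, 'e) chart \<Rightarrow> ('m, 'e) chart \<Rightarrow> 'e \<Rightarrow> 'e" where
  "transition c d = snd d \<circ> inv_into (fst c) (snd c)"

(* The manifold is the union of the chart domains, an open subspace of the Hausdorff, second
   countable space 'm; its dimension is DIM('e). *)
definition smooth_atlas ::
  "('m::{t2_space,second_countable_topology}, 'e::euclidean_space) chart set \<Rightarrow> bool" where
  "smooth_atlas A \<longleftrightarrow>
     (\<forall>c\<in>A. open (fst c) \<and> open (chart_image c) \<and>
        homeomorphism (fst c) (chart_image c) (snd c) (inv_into (fst c) (snd c))) \<and>
     (\<forall>c\<in>A. \<forall>d\<in>A. smooth_on (snd c ` (fst c \<inter> fst d)) (transition c d))"

definition transition_deriv ::
  "('m, 'e::euclidean_space) chart \<Rightarrow> ('m, 'e) chart \<Rightarrow> 'm \<Rightarrow> 'e \<Rightarrow>\<^sub>L 'e" where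
  "transition_deriv c d p = Blinfun (frechet_derivative (transition c d) (at (snd c p)))"

section \<open>Alternating tensors at a point\<close>

(* An alternating k-tensor on a vector space 'v is a function on lists, of which only the values
   on lists of length k matter.  With 'v the tangent space 'e this gives k-covectors, with 'v the
   cotangent space (the dual of 'e) it gives k-vectors. *)

type_synonym 'v alt = "'v list \<Rightarrow> real"
type_synonym 'e covec = "'e \<Rightarrow>\<^sub>L real"

definition alternating :: "nat \<Rightarrow> 'v::real_vector alt \<Rightarrow> bool" where
  "alternating k T \<longleftrightarrow>
     (\<forall>vs i. length vs = k \<and> i < k \<longrightarrow> linear (\<lambda>v. T (vs[i := v]))) \<and>
     (\<forall>vs i j. length vs = k \<and> i < j \<and> j < k \<and> vs ! i = vs ! j \<longrightarrow> T vs = 0)"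

(* Normalised so that (S \<and> T)(v, w) = S v * T w - S w * T v for k = l = 1. *)
definition wedge :: "nat \<Rightarrow> nat \<Rightarrow> 'v alt \<Rightarrow> 'v alt \<Rightarrow> 'v alt" where
  "wedge k l S T vs =
     (\<Sum>\<sigma> | \<sigma> permutes {..<k + l}.
        of_int (sign \<sigma>) * S (map (\<lambda>i. vs ! \<sigma> i) [0..<k]) * T (map (\<lambda>i. vs ! \<sigma> i) [k..<k + l]))
     / (fact k * fact l)"

primrec wedge_power2 :: "'v alt \<Rightarrow> nat \<Rightarrow> 'v alt" where
  "wedge_power2 S 0 = (\<lambda>vs. 1)"
| "wedge_power2 S (Suc n) = wedge 2 (2 * n) S (wedge_power2 S n)"

definition alt_of_covec :: "'e::euclidean_space covec \<Rightarrow> 'e alt" where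
  "alt_of_covec a vs = blinfun_apply a (vs ! 0)"

definition alt_of_vec :: "'e::euclidean_space \<Rightarrow> 'e covec alt" where
  "alt_of_vec v as = blinfun_apply (as ! 0) v"

definition int_prod :: "'e \<Rightarrow> 'e alt \<Rightarrow> 'e alt" where
  "int_prod v S vs = S (v # vs)"

definition sharp :: "'e::euclidean_space covec alt \<Rightarrow> 'e covec \<Rightarrow> 'e" where
  "sharp P a = (THE v. \<forall>b. blinfun_apply b v = P [a, b])"

definition sharp_form :: "nat \<Rightarrow> 'e::euclidean_space covec alt \<Rightarrow> 'e alt \<Rightarrow> 'e covec alt" where
  "sharp_form k P S as = (- 1) ^ k * S (map (sharp P) as)"

(* Here S is a k-covector, and the result is a (k - 1)-vector. *)
definition sharp_form_vec ::
  "nat \<Rightarrow> 'e::euclidean_space covec alt \<Rightarrow> 'e alt \<Rightarrow> 'e \<Rightarrow> 'e covec alt" where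
  "sharp_form_vec k P S v as = (- 1) ^ k * S (map (sharp P) as @ [v])"

section \<open>Tensor fields\<close>

(* A tensor field on the manifold is the family of its representatives in the charts of the atlas,
   each smooth on the image of the chart, related by the usual transformation laws. *)

definition vector_field ::
  "('m, 'e::euclidean_space) chart set \<Rightarrow> (('m, 'e) chart \<Rightarrow> 'e \<Rightarrow> 'e) \<Rightarrow> bool" where
  "vector_field A X \<longleftrightarrow>
     (\<forall>c\<in>A. smooth_on (chart_image c) (X c)) \<and>
     (\<forall>c\<in>A. \<forall>d\<in>A. \<forall>p\<in>fst c \<inter> fst d.
        X d (snd d p) = blinfun_apply (transition_deriv c d p) (X c (snd c p)))"

definition form_field ::
  "('m, 'e::euclidean_space) chart set \<Rightarrow> nat \<Rightarrow> (('m, 'e) chart \<Rightarrow> 'e \<Rightarrow> 'e alt) \<Rightarrow> bool" where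
  "form_field A k \<eta> \<longleftrightarrow>
     (\<forall>c\<in>A. \<forall>x\<in>chart_image c. alternating k (\<eta> c x)) \<and>
     (\<forall>c\<in>A. \<forall>vs. length vs = k \<longrightarrow> smooth_on (chart_image c) (\<lambda>x. \<eta> c x vs)) \<and>
     (\<forall>c\<in>A. \<forall>d\<in>A. \<forall>p\<in>fst c \<inter> fst d. \<forall>vs. length vs = k \<longrightarrow>
        \<eta> c (snd c p) vs = \<eta> d (snd d p) (map (blinfun_apply (transition_deriv c d p)) vs))"

definition one_form ::
  "('m, 'e::euclidean_space) chart set \<Rightarrow> (('m, 'e) chart \<Rightarrow> 'e \<Rightarrow> 'e covec) \<Rightarrow> bool" where
  "one_form A \<theta> \<longleftrightarrow> form_field A 1 (\<lambda>c x. alt_of_covec (\<theta> c x))"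

definition multivector_field ::
  "('m, 'e::euclidean_space) chart set \<Rightarrow> nat \<Rightarrow> (('m, 'e) chart \<Rightarrow> 'e \<Rightarrow> 'e covec alt) \<Rightarrow> bool" where
  "multivector_field A k P \<longleftrightarrow>
     (\<forall>c\<in>A. \<forall>x\<in>chart_image c. alternating k (P c x)) \<and>
     (\<forall>c\<in>A. \<forall>as. length as = k \<longrightarrow> smooth_on (chart_image c) (\<lambda>x. P c x as)) \<and>
     (\<forall>c\<in>A. \<forall>d\<in>A. \<forall>p\<in>fst c \<inter> fst d. \<forall>as. length as = k \<longrightarrow>
        P d (snd d p) as = P c (snd c p) (map (\<lambda>a. a o\<^sub>L transition_deriv c d p) as))"

section \<open>Differential operators in a chart\<close>

(* All operators of this section commute with changes of charts, so that an identity between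
   tensor fields holds if and only if it holds for the representatives in every chart. *)

(* Exterior derivative of a k-form; the formula is evaluated on constant vector fields, whose
   brackets vanish. *)
definition ext_d ::
  "nat \<Rightarrow> ('e::euclidean_space \<Rightarrow> 'e alt) \<Rightarrow> 'e \<Rightarrow> 'e alt" where
  "ext_d k \<eta> x vs =
     (\<Sum>i\<le>k. (- 1) ^ i *
        frechet_derivative (\<lambda>y. \<eta> y (take i vs @ drop (Suc i) vs)) (at x) (vs ! i))"

definition lie_bracket ::
  "('e::euclidean_space \<Rightarrow> 'e) \<Rightarrow> ('e \<Rightarrow> 'e) \<Rightarrow> 'e \<Rightarrow> 'e" where
  "lie_bracket X Y x =
     frechet_derivative Y (at x) (X x) - frechet_derivative X (at x) (Y x)"

(* Lie derivative of a k-vector field P: X(P(a1,...,ak)) minus the sum of the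
   P(a1,...,L_X ai,...,ak), where for a constant 1-form a one has (L_X a)(v) = a (DX v). *)
definition lie_deriv ::
  "nat \<Rightarrow> ('e::euclidean_space \<Rightarrow> 'e) \<Rightarrow> ('e \<Rightarrow> 'e covec alt) \<Rightarrow> 'e \<Rightarrow> 'e covec alt" where
  "lie_deriv k X P x as =
     frechet_derivative (\<lambda>y. P y as) (at x) (X x) -
     (\<Sum>i<k. P x (as[i := as ! i o\<^sub>L Blinfun (frechet_derivative X (at x))]))"

(* Schouten bracket of X 0 \<and> X 1 and Y 0 \<and> Y 1; numbering the factors from 0 instead of 1 does not
   affect the sign (-1)^(i+j). *)
definition schouten_decomposable ::
  "(nat \<Rightarrow> 'e::euclidean_space \<Rightarrow> 'e) \<Rightarrow> (nat \<Rightarrow> 'e \<Rightarrow> 'e) \<Rightarrow> 'e \<Rightarrow> 'e covec alt" where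
  "schouten_decomposable X Y x as =
     (\<Sum>i<2. \<Sum>j<2. (- 1) ^ (i + j) *
        wedge 1 2 (alt_of_vec (lie_bracket (X i) (Y j) x))
          (wedge 1 1 (alt_of_vec (X (1 - i) x)) (alt_of_vec (Y (1 - j) x))) as)"

(* Schouten bracket of bivector fields, by bilinear extension: P is 1/2 times the sum over the
   basis vectors a, b of (P(da,db) a) \<and> b, where da is the coordinate 1-form of a. *)
definition schouten ::
  "('e::euclidean_space \<Rightarrow> 'e covec alt) \<Rightarrow> ('e \<Rightarrow> 'e covec alt) \<Rightarrow> 'e \<Rightarrow> 'e covec alt" where
  "schouten P Q x as =
     (\<Sum>a\<in>Basis. \<Sum>b\<in>Basis. \<Sum>c\<in>Basis. \<Sum>d\<in>Basis.
        schouten_decomposable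
          (\<lambda>i y. if i = 0 then P y [blinfun_inner_right a, blinfun_inner_right b] *\<^sub>R a else b)
          (\<lambda>j y. if j = 0 then Q y [blinfun_inner_right c, blinfun_inner_right d] *\<^sub>R c else d)
          x as) / 4"

section \<open>Twisted contact and twisted Jacobi structures\<close>

(* d\<theta> + \<omega> *)
definition twisted_d ::
  "('e::euclidean_space \<Rightarrow> 'e covec) \<Rightarrow> ('e \<Rightarrow> 'e alt) \<Rightarrow> 'e \<Rightarrow> 'e alt" where
  "twisted_d \<theta> \<omega> x vs = ext_d 1 (\<lambda>y. alt_of_covec (\<theta> y)) x vs + \<omega> x vs"

definition twisted_contact_manifold ::
  "nat \<Rightarrow> ('m::{t2_space,second_countable_topology}, 'e::euclidean_space) chart set \<Rightarrow>
   (('m, 'e) chart \<Rightarrow> 'e \<Rightarrow> 'e covec) \<Rightarrow> (('m, 'e) chart \<Rightarrow> 'e \<Rightarrow> 'e alt) \<Rightarrow> bool" where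
  "twisted_contact_manifold n A \<theta> \<omega> \<longleftrightarrow>
     smooth_atlas A \<and> DIM('e) = 2 * n + 1 \<and> one_form A \<theta> \<and> form_field A 2 \<omega> \<and>
     (\<forall>c\<in>A. \<forall>x\<in>chart_image c. \<exists>vs. length vs = 2 * n + 1 \<and>
        wedge 1 (2 * n) (alt_of_covec (\<theta> c x)) (wedge_power2 (twisted_d (\<theta> c) (\<omega> c) x) n) vs \<noteq> 0)"

definition twisted_jacobi ::
  "('m::{t2_space,second_countable_topology}, 'e::euclidean_space) chart set \<Rightarrow>
   (('m, 'e) chart \<Rightarrow> 'e \<Rightarrow> 'e covec alt) \<Rightarrow> (('m, 'e) chart \<Rightarrow> 'e \<Rightarrow> 'e) \<Rightarrow>
   (('m, 'e) chart \<Rightarrow> 'e \<Rightarrow> 'e alt) \<Rightarrow> bool" where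
  "twisted_jacobi A \<Lambda> E \<omega> \<longleftrightarrow>
     smooth_atlas A \<and> multivector_field A 2 \<Lambda> \<and> vector_field A E \<and> form_field A 2 \<omega> \<and>
     (\<forall>c\<in>A. \<forall>x\<in>chart_image c.
       (\<forall>as. length as = 3 \<longrightarrow>
          schouten (\<Lambda> c) (\<Lambda> c) x as + 2 * wedge 1 2 (alt_of_vec (E c x)) (\<Lambda> c x) as =
          2 * sharp_form 3 (\<Lambda> c x) (ext_d 2 (\<omega> c) x) as +
          2 * wedge 2 1 (sharp_form 2 (\<Lambda> c x) (\<omega> c x)) (alt_of_vec (E c x)) as) \<and>
       (\<forall>as. length as = 2 \<longrightarrow>
          lie_deriv 2 (E c) (\<Lambda> c) x as =
          sharp_form_vec 3 (\<Lambda> c x) (ext_d 2 (\<omega> c) x) (E c x) as -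
          wedge 1 1 (sharp_form_vec 2 (\<Lambda> c x) (\<omega> c x) (E c x)) (alt_of_vec (E c x)) as))"

end

theory Submission
  imports Defs
begin

text \<open>
  Both identities are equalities of tensors at a point of a chart, so it suffices to test them on
  constant covectors. Write \<open>\<Omega> = d\<theta> + \<omega>\<close> and \<open>sh \<alpha>\<close> for the Hamiltonian vector of a covector \<open>\<alpha>\<close>. The
  assumptions give \<open>\<theta> (sh \<alpha>) = 0\<close> and \<open>\<Omega> (sh \<alpha>, sh \<beta>) = \<Lambda> (\<alpha>, \<beta>)\<close>, so \<open>\<Lambda>\<close> is, on Hamiltonian vectors,
  the 2-form \<open>\<Omega>\<close>, and \<open>d\<Omega> = d\<omega>\<close>. Thus \<open>\<Lambda>\<close> fails to be a Jacobi bivector for two reasons only: \<open>\<Omega>\<close> is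
  not closed, and \<open>d\<theta>\<close> differs from \<open>\<Omega>\<close> by \<open>\<omega>\<close>. These are the two twisting terms.

  To make this precise, the Schouten square of \<open>\<Lambda>\<close> on constant \<open>\<alpha>, \<beta>, \<gamma>\<close> is twice the cyclic sum of
  the derivatives of \<open>\<Lambda> (\<beta>, \<gamma>)\<close> along \<open>sh \<alpha>\<close> (lemma \<open>schouten_self\<close>). Differentiating the equation that
  defines \<open>\<Lambda>\<close> expresses the derivative of \<open>\<Lambda> (\<alpha>, \<beta>)\<close> in any direction by the derivatives of the
  coefficients of \<open>\<Omega>\<close> and of \<open>\<theta>\<close> in that direction (lemma \<open>D\<Omega>_sh_sh\<close>). In the cyclic sum, the
  derivatives of \<open>\<Omega>\<close> become \<open>d\<Omega> = d\<omega>\<close>, by Schwarz's theorem, and the derivatives of \<open>\<theta>\<close> become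
  \<open>d\<theta> = \<Omega> - \<omega>\<close>. For the Lie derivative along \<open>E\<close>, the same lemma is used in the direction \<open>E\<close>, together
  with the derivative of the equation \<open>\<Omega> (E, v) = 0\<close>.
\<close>

section \<open>Derivatives\<close>

lemma has_derivative_along_line:
  fixes f :: "'a::real_normed_vector \<Rightarrow> real"
  assumes "f differentiable (at (p + t *\<^sub>R v))"
  shows "((\<lambda>s. f (p + s *\<^sub>R v)) has_real_derivative
           frechet_derivative f (at (p + t *\<^sub>R v)) v) (at t)"
proof -
  let ?f' = "frechet_derivative f (at (p + t *\<^sub>R v))"
  have f: "(f has_derivative ?f') (at (p + t *\<^sub>R v))"
    using assms frechet_derivative_works by blast
  have "((\<lambda>s. p + s *\<^sub>R v) has_derivative (\<lambda>s. s *\<^sub>R v)) (at t)"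
    by (auto intro!: derivative_eq_intros)
  from has_derivative_compose[OF this f]
  have "((\<lambda>s. f (p + s *\<^sub>R v)) has_derivative (\<lambda>s. ?f' (s *\<^sub>R v))) (at t)" .
  moreover have "(\<lambda>s. ?f' (s *\<^sub>R v)) = (*) (?f' v)"
    using has_derivative_linear[OF f] by (simp add: linear_scale fun_eq_iff mult.commute)
  ultimately show ?thesis
    by (simp add: has_field_derivative_def)
qed

text \<open>
  Two applications of the mean value theorem: first in the direction \<open>u\<close> to the difference of \<open>f\<close>
  along two parallel edges of a parallelogram, then in the direction \<open>w\<close> to the derivative of \<open>f\<close>
  along \<open>u\<close>. The left-hand side is symmetric in \<open>u\<close> and \<open>w\<close>, the right-hand side is not; this is what
  makes mixed derivatives commute.
\<close>
lemma second_difference_mean_value: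
  fixes f :: "'a::real_normed_vector \<Rightarrow> real"
  assumes h: "0 < h"
    and U: "\<And>s t. 0 \<le> s \<Longrightarrow> s \<le> h \<Longrightarrow> 0 \<le> t \<Longrightarrow> t \<le> h \<Longrightarrow> x + s *\<^sub>R u + t *\<^sub>R w \<in> U"
    and f: "\<And>y. y \<in> U \<Longrightarrow> f differentiable (at y)"
    and fu: "\<And>y. y \<in> U \<Longrightarrow> (\<lambda>z. frechet_derivative f (at z) u) differentiable (at y)"
  shows "\<exists>s t. 0 < s \<and> s < h \<and> 0 < t \<and> t < h \<and>
    f (x + h *\<^sub>R u + h *\<^sub>R w) - f (x + h *\<^sub>R u) - f (x + h *\<^sub>R w) + f x =
    h * h * frechet_derivative (\<lambda>z. frechet_derivative f (at z) u)
      (at (x + s *\<^sub>R u + t *\<^sub>R w)) w"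
proof -
  let ?g = "\<lambda>z. frechet_derivative f (at z) u"
  let ?\<phi> = "\<lambda>s. f (x + h *\<^sub>R w + s *\<^sub>R u) - f (x + s *\<^sub>R u)"
  have "\<exists>s. 0 < s \<and> s < h \<and> ?\<phi> h - ?\<phi> 0 = (h - 0) * (?g (x + h *\<^sub>R w + s *\<^sub>R u) - ?g (x + s *\<^sub>R u))"
  proof (rule MVT2[OF h])
    fix s :: real assume "0 \<le> s" "s \<le> h"
    then have "x + h *\<^sub>R w + s *\<^sub>R u \<in> U" "x + s *\<^sub>R u \<in> U"
      using U[of s h] U[of s 0] h by (simp_all add: ac_simps)
    then show "DERIV ?\<phi> s :> ?g (x + h *\<^sub>R w + s *\<^sub>R u) - ?g (x + s *\<^sub>R u)"
      by (intro DERIV_diff has_derivative_along_line f)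
  qed
  then obtain s where s: "0 < s" "s < h"
    and 1: "?\<phi> h - ?\<phi> 0 = h * (?g (x + h *\<^sub>R w + s *\<^sub>R u) - ?g (x + s *\<^sub>R u))"
    by auto
  have "\<exists>t. 0 < t \<and> t < h \<and> ?g (x + s *\<^sub>R u + h *\<^sub>R w) - ?g (x + s *\<^sub>R u + 0 *\<^sub>R w) =
      (h - 0) * frechet_derivative ?g (at (x + s *\<^sub>R u + t *\<^sub>R w)) w"
    using s U by (intro MVT2[OF h] has_derivative_along_line fu) auto
  then obtain t where t: "0 < t" "t < h"
    and 2: "?g (x + s *\<^sub>R u + h *\<^sub>R w) - ?g (x + s *\<^sub>R u) =
      h * frechet_derivative ?g (at (x + s *\<^sub>R u + t *\<^sub>R w)) w"
    by auto
  show ?thesis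
    using s t 1 2 by (intro exI[of _ s] exI[of _ t]) (simp add: algebra_simps)
qed

text \<open>
  Schwarz's theorem on mixed derivatives. Both orders of differentiation are values, at points of a
  small parallelogram, of the same second difference quotient; the parallelogram shrinks to \<open>x\<close> and
  the second derivatives are continuous.
\<close>
lemma second_derivative_commute:
  fixes f :: "'a::real_normed_vector \<Rightarrow> real"
  assumes U: "open U" "x \<in> U"
    and f: "\<And>y. y \<in> U \<Longrightarrow> f differentiable (at y)"
    and f': "\<And>v y. y \<in> U \<Longrightarrow> (\<lambda>z. frechet_derivative f (at z) v) differentiable (at y)"
    and f'': "\<And>v w. continuous_on U
      (\<lambda>y. frechet_derivative (\<lambda>z. frechet_derivative f (at z) v) (at y) w)"
  shows "frechet_derivative (\<lambda>z. frechet_derivative f (at z) u) (at x) w =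
    frechet_derivative (\<lambda>z. frechet_derivative f (at z) w) (at x) u"
proof -
  let ?H = "\<lambda>u w y. frechet_derivative (\<lambda>z. frechet_derivative f (at z) u) (at y) w"
  have "\<bar>?H u w x - ?H w u x\<bar> \<le> e" if e: "e > 0" for e
  proof -
    have near: "\<exists>d>0. \<forall>y. dist y x < d \<longrightarrow> \<bar>?H v v' y - ?H v v' x\<bar> < e / 2" for v v'
    proof -
      have "isCont (?H v v') x"
        using f'' U continuous_on_eq_continuous_at by blast
      then show ?thesis
        using e unfolding continuous_at_eps_delta dist_real_def by (meson half_gt_zero)
    qed
    obtain d1 where d1: "d1 > 0" "\<And>y. dist y x < d1 \<Longrightarrow> \<bar>?H u w y - ?H u w x\<bar> < e / 2"
      using near by blast
    obtain d2 where d2: "d2 > 0" "\<And>y. dist y x < d2 \<Longrightarrow> \<bar>?H w u y - ?H w u x\<bar> < e / 2"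
      using near by blast
    obtain d3 where d3: "d3 > 0" "\<And>y. dist y x < d3 \<Longrightarrow> y \<in> U"
      using U open_dist by blast
    define d where "d = min d1 (min d2 d3)"
    \<comment> \<open>small enough for the parallelogram with sides \<open>h *\<^sub>R u\<close>, \<open>h *\<^sub>R w\<close> to stay within \<open>d\<close> of \<open>x\<close>\<close>
    define h where "h = d / (norm u + norm w + 1)"
    have pos: "norm u + norm w + 1 > 0"
      by (smt (verit) norm_ge_zero)
    have d: "d > 0" using d1 d2 d3 by (simp add: d_def)
    then have h: "h > 0" using pos by (simp add: h_def)
    have close: "dist (x + s *\<^sub>R u + t *\<^sub>R w) x < d"
      if "0 \<le> s" "s \<le> h" "0 \<le> t" "t \<le> h" for s t
    proof -
      have "norm (s *\<^sub>R u + t *\<^sub>R w) \<le> s * norm u + t * norm w"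
        using norm_triangle_ineq[of "s *\<^sub>R u" "t *\<^sub>R w"] that by simp
      also have "\<dots> \<le> h * norm u + h * norm w"
        using that by (intro add_mono mult_right_mono) auto
      also have "\<dots> < h * (norm u + norm w + 1)"
        using h by (simp add: algebra_simps)
      also have "\<dots> = d" using pos by (simp add: h_def)
      finally show ?thesis by (simp add: dist_norm add.assoc)
    qed
    have U1: "x + s *\<^sub>R u + t *\<^sub>R w \<in> U" if "0 \<le> s" "s \<le> h" "0 \<le> t" "t \<le> h" for s t
      using close[OF that] d3(2) by (simp add: d_def)
    have U2: "x + s *\<^sub>R w + t *\<^sub>R u \<in> U" if "0 \<le> s" "s \<le> h" "0 \<le> t" "t \<le> h" for s t
      using U1[of t s] that by (simp add: ac_simps)
    let ?\<Delta> = "f (x + h *\<^sub>R u + h *\<^sub>R w) - f (x + h *\<^sub>R u) - f (x + h *\<^sub>R w) + f x"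
    obtain s t where 1: "0 < s" "s < h" "0 < t" "t < h" "?\<Delta> = h * h * ?H u w (x + s *\<^sub>R u + t *\<^sub>R w)"
      using second_difference_mean_value[OF h U1 f f'] by blast
    obtain s' t' where 2: "0 < s'" "s' < h" "0 < t'" "t' < h"
      "f (x + h *\<^sub>R w + h *\<^sub>R u) - f (x + h *\<^sub>R w) - f (x + h *\<^sub>R u) + f x =
        h * h * ?H w u (x + s' *\<^sub>R w + t' *\<^sub>R u)"
      using second_difference_mean_value[OF h U2 f f'] by blast
    have "h * h * ?H u w (x + s *\<^sub>R u + t *\<^sub>R w) = h * h * ?H w u (x + t' *\<^sub>R u + s' *\<^sub>R w)"
      using 1(5) 2(5) by (simp add: algebra_simps)
    then have "?H u w (x + s *\<^sub>R u + t *\<^sub>R w) = ?H w u (x + t' *\<^sub>R u + s' *\<^sub>R w)"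
      using h by simp
    moreover have "\<bar>?H u w (x + s *\<^sub>R u + t *\<^sub>R w) - ?H u w x\<bar> < e / 2"
      using d1(2) close[of s t] 1 by (simp add: d_def)
    moreover have "\<bar>?H w u (x + t' *\<^sub>R u + s' *\<^sub>R w) - ?H w u x\<bar> < e / 2"
      using d2(2) close[of t' s'] 2 by (simp add: d_def)
    ultimately show ?thesis by linarith
  qed
  then show ?thesis
    by (metis abs_le_zero_iff eq_iff_diff_eq_0 field_le_epsilon add_0)
qed

lemma smooth_on_differentiable:
  assumes "smooth_on S f" "x \<in> S"
  shows "f differentiable (at x)"
  using assms Ck_on.simps(2)[of 0 S f] unfolding smooth_on_def by blast

lemma smooth_on_frechet_derivative:
  assumes "smooth_on S f"
  shows "smooth_on S (\<lambda>x. frechet_derivative f (at x) v)"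
  using assms Ck_on.simps(2) unfolding smooth_on_def by blast

lemma smooth_on_continuous_on:
  assumes "smooth_on S f"
  shows "continuous_on S f"
  using assms Ck_on.simps(1) unfolding smooth_on_def by blast

text \<open>
  The product rule for a field of linear forms evaluated on a vector field. Fields of tensors are only
  known to be smooth coefficient by coefficient, so the pairing is expanded in a basis. Only one slot
  is varied at a time; this is enough below, and avoids any product rule for multilinear maps.
\<close>
lemma has_derivative_pairing:
  fixes L :: "'a::real_normed_vector \<Rightarrow> 'e::euclidean_space \<Rightarrow> real"
  assumes U: "open U" "x \<in> U"
    and L: "\<And>y. y \<in> U \<Longrightarrow> linear (L y)" "\<And>v. (\<lambda>y. L y v) differentiable (at x)"
    and V: "V differentiable (at x)"
  shows "((\<lambda>y. L y (V y)) has_derivative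
    (\<lambda>u. frechet_derivative (\<lambda>y. L y (V x)) (at x) u + L x (frechet_derivative V (at x) u))) (at x)"
proof -
  let ?DL = "\<lambda>v. frechet_derivative (\<lambda>y. L y v) (at x)"
  let ?DV = "frechet_derivative V (at x)"
  have expand: "L y v = (\<Sum>b\<in>Basis. (v \<bullet> b) * L y b)" if "y \<in> U" for y v
    using linear_sum[OF L(1)[OF that], of "\<lambda>b. (v \<bullet> b) *\<^sub>R b" Basis]
    by (simp add: euclidean_representation linear_scale[OF L(1)[OF that]])
  have dL: "((\<lambda>y. L y v) has_derivative ?DL v) (at x)" for v
    using L(2) frechet_derivative_works by blast
  have dV: "(V has_derivative ?DV) (at x)"
    using V frechet_derivative_works by blast
  have "((\<lambda>y. \<Sum>b\<in>Basis. (V x \<bullet> b) * L y b) has_derivative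
      (\<lambda>u. \<Sum>b\<in>Basis. (V x \<bullet> b) * ?DL b u)) (at x)"
    by (intro has_derivative_sum has_derivative_mult_right dL)
  from has_derivative_transform_within_open[OF this U] expand
  have "((\<lambda>y. L y (V x)) has_derivative (\<lambda>u. \<Sum>b\<in>Basis. (V x \<bullet> b) * ?DL b u)) (at x)"
    by simp
  then have 1: "?DL (V x) = (\<lambda>u. \<Sum>b\<in>Basis. (V x \<bullet> b) * ?DL b u)"
    by (rule frechet_derivative_at[symmetric])
  have "((\<lambda>y. \<Sum>b\<in>Basis. (V y \<bullet> b) * L y b) has_derivative
      (\<lambda>u. \<Sum>b\<in>Basis. (V x \<bullet> b) * ?DL b u + (?DV u \<bullet> b) * L x b)) (at x)"
    by (intro has_derivative_sum has_derivative_mult has_derivative_inner_left dL dV)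
  from has_derivative_transform_within_open[OF this U] expand
  have "((\<lambda>y. L y (V y)) has_derivative
      (\<lambda>u. \<Sum>b\<in>Basis. (V x \<bullet> b) * ?DL b u + (?DV u \<bullet> b) * L x b)) (at x)"
    by simp
  then show ?thesis
    by (simp add: 1 sum.distrib expand[OF U(2), of "?DV _"])
qed

section \<open>Bivectors and wedge products of low degree\<close>

lemma alternating_2_swap:
  assumes "alternating 2 T"
  shows "T [v, w] = - T [w, v]"
proof -
  have lin: "linear (\<lambda>v. T ([a, b][i := v]))" if "i < 2" for a b and i :: nat
    using assms that unfolding alternating_def by (metis length_Cons list.size(3) numeral_2_eq_2)
  have alt: "T [a, a] = 0" for a
    using assms unfolding alternating_def
    by (elim conjE allE[of _ "[a, a]"] allE[of _ "0::nat"] allE[of _ "1::nat"]) auto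
  have 1: "T [a + b, c] = T [a, c] + T [b, c]" for a b c
    using linear_add[OF lin[of 0 a c], of a b] by simp
  have 2: "T [c, a + b] = T [c, a] + T [c, b]" for a b c
    using linear_add[OF lin[of 1 c a], of a b] by simp
  show ?thesis
    using alt[of "v + w"] alt[of v] alt[of w] unfolding 1 2 by simp
qed

lemma alternating_2_linear:
  assumes "alternating 2 T"
  shows "linear (\<lambda>v. T [v, w])" and "linear (\<lambda>w. T [v, w])"
proof -
  have lin: "linear (\<lambda>v. T ([a, b][i := v]))" if "i < 2" for a b and i :: nat
    using assms that unfolding alternating_def by (metis length_Cons list.size(3) numeral_2_eq_2)
  show "linear (\<lambda>v. T [v, w])" "linear (\<lambda>w. T [v, w])"
    using lin[of 0 v w] lin[of 1 v w] by simp_all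
qed

lemma covec_expand:
  fixes b :: "'e::euclidean_space covec"
  shows "b = (\<Sum>e\<in>Basis. blinfun_apply b e *\<^sub>R blinfun_inner_right e)"
proof (rule blinfun_eqI)
  fix v
  have "blinfun_apply b v = blinfun_apply b (\<Sum>e\<in>Basis. (v \<bullet> e) *\<^sub>R e)"
    by (simp add: euclidean_representation)
  then show "blinfun_apply b v =
      blinfun_apply (\<Sum>e\<in>Basis. blinfun_apply b e *\<^sub>R blinfun_inner_right e) v"
    by (simp add: blinfun.bilinear_simps blinfun.sum_left blinfun.sum_right inner_commute mult.commute)
qed

lemma linear_covec_expand:
  fixes L :: "'e::euclidean_space covec \<Rightarrow> real"
  assumes "linear L"
  shows "L b = (\<Sum>e\<in>Basis. blinfun_apply b e * L (blinfun_inner_right e))"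
proof -
  have "L b = L (\<Sum>e\<in>Basis. blinfun_apply b e *\<^sub>R blinfun_inner_right e)"
    by (rule arg_cong[OF covec_expand])
  also have "\<dots> = (\<Sum>e\<in>Basis. blinfun_apply b e * L (blinfun_inner_right e))"
    by (simp add: linear_sum[OF assms] linear_scale[OF assms])
  finally show ?thesis .
qed

text \<open>
  The definite description in the definition of \<open>sharp\<close> is well defined because a vector is determined
  by its coordinates, and its coordinates are smooth when the bivector is.
\<close>
lemma sharp_eq_sum:
  assumes "alternating 2 P"
  shows "sharp P a = (\<Sum>e\<in>Basis. P [a, blinfun_inner_right e] *\<^sub>R e)"
  unfolding sharp_def
proof (rule the_equality)
  show "\<forall>b. blinfun_apply b (\<Sum>e\<in>Basis. P [a, blinfun_inner_right e] *\<^sub>R e) = P [a, b]"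
  proof
    fix b
    show "blinfun_apply b (\<Sum>e\<in>Basis. P [a, blinfun_inner_right e] *\<^sub>R e) = P [a, b]"
      using linear_covec_expand[OF alternating_2_linear(2)[OF assms], of a b]
      by (simp add: blinfun.sum_right blinfun.scaleR_right mult.commute)
  qed
next
  fix v assume v: "\<forall>b. blinfun_apply b v = P [a, b]"
  have "v = (\<Sum>e\<in>Basis. (v \<bullet> e) *\<^sub>R e)"
    by (simp add: euclidean_representation)
  also have "\<dots> = (\<Sum>e\<in>Basis. P [a, blinfun_inner_right e] *\<^sub>R e)"
  proof (intro sum.cong refl)
    fix e :: 'a
    show "(v \<bullet> e) *\<^sub>R e = P [a, blinfun_inner_right e] *\<^sub>R e"
      using v[THEN spec, of "blinfun_inner_right e"] by (simp add: inner_commute)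
  qed
  finally show "v = (\<Sum>e\<in>Basis. P [a, blinfun_inner_right e] *\<^sub>R e)" .
qed

lemma apply_sharp:
  assumes "alternating 2 P"
  shows "blinfun_apply b (sharp P a) = P [a, b]"
  unfolding sharp_eq_sum[OF assms]
  using linear_covec_expand[OF alternating_2_linear(2)[OF assms], of a b]
  by (simp add: blinfun.sum_right blinfun.scaleR_right mult.commute)

lemma wedge_1_1:
  "wedge 1 1 S T [a, b] = S [a] * T [b] - S [b] * T [a]"
proof -
  have *: "{..<2::nat} = insert 1 {0}" by auto
  have fin: "finite {0::nat}" "1 \<notin> {0::nat}" by auto
  have "wedge 1 1 S T [a, b] = (\<Sum>\<sigma> | \<sigma> permutes {..<2}.
      of_int (sign \<sigma>) * S (map (\<lambda>i. [a, b] ! \<sigma> i) [0..<1]) * T (map (\<lambda>i. [a, b] ! \<sigma> i) [1..<2]))"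
    by (simp add: wedge_def numeral_2_eq_2)
  then show ?thesis
    unfolding * sum_over_permutations_insert[OF fin] permutes_sing
    by (simp add: numeral_2_eq_2 upt_rec sign_swap_id permutation_swap_id sign_compose sign_id)
qed

text \<open>
  The six permutations of three indices, obtained by inserting one index after the other. The two ways
  of splitting three arguments are read off from this by evaluating \<open>take\<close> and \<open>drop\<close>.
\<close>
lemma wedge_3_expand:
  assumes "k + l = 3"
  shows "wedge k l S T vs = (let f = (\<lambda>a b c.
      S (take k [vs ! a, vs ! b, vs ! c]) * T (drop k [vs ! a, vs ! b, vs ! c])) in
    (f 0 1 2 - f 1 0 2 - f 2 1 0 - f 0 2 1 + f 1 2 0 + f 2 0 1) / (fact k * fact l))"
proof -
  have fin: "finite {1, 0::nat}" "2 \<notin> {1, 0::nat}" "finite {0::nat}" "1 \<notin> {0::nat}"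
    by auto
  have *: "{..<3::nat} = insert 2 (insert 1 {0})" by auto
  have upt: "[0..<3] = [0, 1, 2::nat]"
    by (simp add: upt_rec)
  have split: "map f [0..<k] = take k (map f [0..<3])" "map f [k..<3] = drop k (map f [0..<3])"
    for f :: "nat \<Rightarrow> 'a"
    using assms by (simp_all add: take_map drop_map)
  show ?thesis
    unfolding wedge_def assms split upt * sum_over_permutations_insert[OF fin(1,2)]
      sum_over_permutations_insert[OF fin(3,4)] permutes_sing
    by (simp add: Let_def sign_swap_id permutation_swap_id sign_compose permutation_compose sign_id
        algebra_simps transpose_def)
qed

lemma wedge_1_2:
  assumes "\<And>v w. T [v, w] = - T [w, v]"
  shows "wedge 1 2 S T [a, b, c] = S [a] * T [b, c] + S [b] * T [c, a] + S [c] * T [a, b]"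
  using assms[of c b] assms[of a c] assms[of b a]
  by (simp add: wedge_3_expand Let_def algebra_simps numeral_2_eq_2)

lemma wedge_2_1:
  assumes "\<And>v w. S [v, w] = - S [w, v]"
  shows "wedge 2 1 S T [a, b, c] = S [a, b] * T [c] + S [b, c] * T [a] + S [c, a] * T [b]"
  using assms[of c b] assms[of a c] assms[of b a]
  by (simp add: wedge_3_expand Let_def algebra_simps numeral_2_eq_2)

lemma wedge_vec_vec_vec:
  "wedge 1 2 (alt_of_vec u) (wedge 1 1 (alt_of_vec v) (alt_of_vec w)) [\<alpha>, \<beta>, \<gamma>] =
    blinfun_apply \<alpha> u * (blinfun_apply \<beta> v * blinfun_apply \<gamma> w - blinfun_apply \<gamma> v * blinfun_apply \<beta> w) +
    blinfun_apply \<beta> u * (blinfun_apply \<gamma> v * blinfun_apply \<alpha> w - blinfun_apply \<alpha> v * blinfun_apply \<gamma> w) +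
    blinfun_apply \<gamma> u * (blinfun_apply \<alpha> v * blinfun_apply \<beta> w - blinfun_apply \<beta> v * blinfun_apply \<alpha> w)"
  by (subst wedge_1_2) (simp_all add: wedge_1_1[unfolded One_nat_def] alt_of_vec_def)

section \<open>The Schouten square of a bivector field\<close>

lemma frechet_derivative_scaleR_const:
  fixes f :: "'a::real_normed_vector \<Rightarrow> real"
  assumes "f differentiable (at x)"
  shows "frechet_derivative (\<lambda>y. f y *\<^sub>R c) (at x) v = frechet_derivative f (at x) v *\<^sub>R c"
proof -
  have "((\<lambda>y. f y *\<^sub>R c) has_derivative (\<lambda>v. frechet_derivative f (at x) v *\<^sub>R c)) (at x)"
    using assms frechet_derivative_works by (intro has_derivative_scaleR_left) blast
  from frechet_derivative_at[OF this] show ?thesis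
    by (rule fun_cong[symmetric])
qed

abbreviation wedge_vecs :: "'e::euclidean_space \<Rightarrow> 'e \<Rightarrow> 'e \<Rightarrow> 'e covec alt" where
  "wedge_vecs u v w \<equiv> wedge 1 2 (alt_of_vec u) (wedge 1 1 (alt_of_vec v) (alt_of_vec w))"

text \<open>
  The vector fields in the Schouten bracket of two monomials \<open>f a \<and> b\<close> and \<open>g c \<and> d\<close> have constant
  directions, so each Lie bracket only differentiates a coefficient and the bracket of \<open>b\<close> and \<open>d\<close>
  vanishes.
\<close>
lemma schouten_decomposable_coordinate:
  assumes "f differentiable (at x)" "g differentiable (at x)"
  shows "schouten_decomposable (\<lambda>i y. if i = 0 then f y *\<^sub>R a else b)
      (\<lambda>j y. if j = 0 then g y *\<^sub>R c else d) x [\<alpha>, \<beta>, \<gamma>] =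
    f x * frechet_derivative g (at x) a * wedge_vecs c b d [\<alpha>, \<beta>, \<gamma>] -
    g x * frechet_derivative f (at x) c * wedge_vecs a b d [\<alpha>, \<beta>, \<gamma>] +
    g x * frechet_derivative f (at x) d * wedge_vecs a b c [\<alpha>, \<beta>, \<gamma>] -
    f x * frechet_derivative g (at x) b * wedge_vecs c a d [\<alpha>, \<beta>, \<gamma>]"
proof -
  have lin: "linear (frechet_derivative f (at x))" "linear (frechet_derivative g (at x))"
    using assms(1,2) frechet_derivative_works has_derivative_linear by blast+
  note scale = linear_scale[OF lin(1)] linear_scale[OF lin(2)]
  have fg: "lie_bracket (\<lambda>y. f y *\<^sub>R a) (\<lambda>y. g y *\<^sub>R c) x =
      (f x * frechet_derivative g (at x) a) *\<^sub>R c - (g x * frechet_derivative f (at x) c) *\<^sub>R a"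
    by (simp add: lie_bracket_def frechet_derivative_scaleR_const assms(1,2) scale)
  have f1: "lie_bracket (\<lambda>y. f y *\<^sub>R a) (\<lambda>y. d) x = - (frechet_derivative f (at x) d *\<^sub>R a)"
    and g1: "lie_bracket (\<lambda>y. b) (\<lambda>y. g y *\<^sub>R c) x = frechet_derivative g (at x) b *\<^sub>R c"
    and "lie_bracket (\<lambda>y. b) (\<lambda>y. d) x = 0"
    by (simp_all add: lie_bracket_def frechet_derivative_scaleR_const assms(1,2))
  then show ?thesis
    unfolding schouten_decomposable_def wedge_vec_vec_vec
    by (simp add: numeral_2_eq_2 wedge_vec_vec_vec[unfolded numeral_2_eq_2 One_nat_def]
        fg blinfun.bilinear_simps algebra_simps)
qed

lemma sum_swap_pairs:
  "(\<Sum>a\<in>A. \<Sum>b\<in>B. \<Sum>c\<in>C. \<Sum>d\<in>D. F a b c d) = (\<Sum>c\<in>C. \<Sum>d\<in>D. \<Sum>a\<in>A. \<Sum>b\<in>B. F a b c d)"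
proof -
  have "(\<Sum>a\<in>A. \<Sum>b\<in>B. \<Sum>c\<in>C. \<Sum>d\<in>D. F a b c d) = (\<Sum>a\<in>A. \<Sum>c\<in>C. \<Sum>b\<in>B. \<Sum>d\<in>D. F a b c d)"
    by (intro sum.cong refl) (rule sum.swap)
  also have "\<dots> = (\<Sum>a\<in>A. \<Sum>c\<in>C. \<Sum>d\<in>D. \<Sum>b\<in>B. F a b c d)"
    by (intro sum.cong refl) (rule sum.swap)
  also have "\<dots> = (\<Sum>c\<in>C. \<Sum>a\<in>A. \<Sum>d\<in>D. \<Sum>b\<in>B. F a b c d)"
    by (rule sum.swap)
  also have "\<dots> = (\<Sum>c\<in>C. \<Sum>d\<in>D. \<Sum>a\<in>A. \<Sum>b\<in>B. F a b c d)"
    by (intro sum.cong refl) (rule sum.swap)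
  finally show ?thesis .
qed

text \<open>
  On constant covectors the Schouten square is twice the cyclic sum of the derivatives of \<open>P\<close> along
  its own Hamiltonian vectors. Up to exchanging the names of the summation indices and the
  antisymmetry of \<open>P\<close> and of the wedge product, the four terms that the monomials produce all have the
  same sum, which therefore cancels the factor 1/4.
\<close>
lemma schouten_self:
  fixes P :: "'e::euclidean_space \<Rightarrow> 'e covec alt"
  assumes U: "open U" "x \<in> U"
    and alt: "\<And>y. y \<in> U \<Longrightarrow> alternating 2 (P y)"
    and diff: "\<And>a b. (\<lambda>y. P y [a, b]) differentiable (at x)"
  shows "schouten P P x [\<alpha>, \<beta>, \<gamma>] =
    2 * (frechet_derivative (\<lambda>y. P y [\<beta>, \<gamma>]) (at x) (sharp (P x) \<alpha>) +
         frechet_derivative (\<lambda>y. P y [\<gamma>, \<alpha>]) (at x) (sharp (P x) \<beta>) +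
         frechet_derivative (\<lambda>y. P y [\<alpha>, \<beta>]) (at x) (sharp (P x) \<gamma>))"
proof -
  define p where "p a b = P x [blinfun_inner_right a, blinfun_inner_right b]" for a b
  define DP where "DP r s = frechet_derivative (\<lambda>y. P y [r, s]) (at x)" for r s
  define D where "D c d = DP (blinfun_inner_right c) (blinfun_inner_right d)" for c d
  define t where "t u v w = wedge_vecs u v w [\<alpha>, \<beta>, \<gamma>]" for u v w
  have P: "alternating 2 (P x)" using alt U by blast
  have DP: "((\<lambda>y. P y [r, s]) has_derivative DP r s) (at x)" for r s
    using diff frechet_derivative_works unfolding DP_def by blast
  have DP_lin: "linear (DP r s)" for r s
    using DP has_derivative_linear by blast
  have DP_swap: "DP s r u = - DP r s u" for r s u
  proof -
    have "((\<lambda>y. P y [s, r]) has_derivative (\<lambda>u. - DP r s u)) (at x)"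
      by (rule has_derivative_transform_within_open[OF has_derivative_minus[OF DP] U])
        (metis alternating_2_swap[OF alt])
    from has_derivative_unique[OF DP this] show ?thesis
      by (rule fun_cong)
  qed
  have DP_expand: "DP r s u = (\<Sum>c\<in>Basis. \<Sum>d\<in>Basis. blinfun_apply r c * (blinfun_apply s d * D c d u))" for r s u
  proof -
    have expand: "(\<Sum>c\<in>Basis. \<Sum>d\<in>Basis. blinfun_apply r c * (blinfun_apply s d *
        P y [blinfun_inner_right c, blinfun_inner_right d])) = P y [r, s]" if "y \<in> U" for y
    proof -
      note lin = alternating_2_linear[OF alt[OF that]]
      have "P y [r, s] = (\<Sum>c\<in>Basis. blinfun_apply r c * P y [blinfun_inner_right c, s])"
        by (rule linear_covec_expand[OF lin(1)])
      also have "\<dots> = (\<Sum>c\<in>Basis. blinfun_apply r c *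
          (\<Sum>d\<in>Basis. blinfun_apply s d * P y [blinfun_inner_right c, blinfun_inner_right d]))"
        by (intro sum.cong refl arg_cong2[where f = "(*)"] linear_covec_expand lin(2))
      finally show ?thesis by (simp add: sum_distrib_left)
    qed
    have "((\<lambda>y. \<Sum>c\<in>Basis. \<Sum>d\<in>Basis. blinfun_apply r c * (blinfun_apply s d *
        P y [blinfun_inner_right c, blinfun_inner_right d])) has_derivative
      (\<lambda>u. \<Sum>c\<in>Basis. \<Sum>d\<in>Basis. blinfun_apply r c * (blinfun_apply s d * D c d u))) (at x)"
      unfolding D_def by (intro has_derivative_sum has_derivative_mult_right DP)
    from has_derivative_unique[OF DP has_derivative_transform_within_open[OF this U expand]]
    show ?thesis by (rule fun_cong)
  qed
  have t: "t c b d =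
      blinfun_apply \<alpha> c * (blinfun_apply \<beta> b * blinfun_apply \<gamma> d - blinfun_apply \<gamma> b * blinfun_apply \<beta> d) +
      blinfun_apply \<beta> c * (blinfun_apply \<gamma> b * blinfun_apply \<alpha> d - blinfun_apply \<alpha> b * blinfun_apply \<gamma> d) +
      blinfun_apply \<gamma> c * (blinfun_apply \<alpha> b * blinfun_apply \<beta> d - blinfun_apply \<beta> b * blinfun_apply \<alpha> d)" for c b d
    unfolding t_def wedge_vec_vec_vec ..
  have t_swap: "t c d b = - t c b d" for b c d
    by (simp add: t algebra_simps)
  have p_swap: "p b a = - p a b" for a b
    unfolding p_def by (rule alternating_2_swap[OF P])

  define W where "W = (\<Sum>a\<in>Basis. \<Sum>b\<in>Basis. \<Sum>c\<in>Basis. \<Sum>d\<in>Basis. p a b * D c d a * t c b d)"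
  have W2: "(\<Sum>a\<in>Basis. \<Sum>b\<in>Basis. \<Sum>c\<in>Basis. \<Sum>d\<in>Basis. p c d * D a b c * t a b d) = - W"
  proof -
    have "(\<Sum>a\<in>Basis. \<Sum>b\<in>Basis. \<Sum>c\<in>Basis. \<Sum>d\<in>Basis. p c d * D a b c * t a b d) =
        (\<Sum>c\<in>Basis. \<Sum>d\<in>Basis. \<Sum>a\<in>Basis. \<Sum>b\<in>Basis. p c d * D a b c * t a b d)"
      by (rule sum_swap_pairs)
    also have "\<dots> = (\<Sum>c\<in>Basis. \<Sum>d\<in>Basis. \<Sum>a\<in>Basis. \<Sum>b\<in>Basis. - (p c d * D a b c * t a d b))"
      by (intro sum.cong refl) (metis t_swap mult_minus_right)
    finally show ?thesis by (simp add: W_def sum_negf)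
  qed
  have W4: "(\<Sum>a\<in>Basis. \<Sum>b\<in>Basis. \<Sum>c\<in>Basis. \<Sum>d\<in>Basis. p a b * D c d b * t c a d) = - W"
  proof -
    have "(\<Sum>a\<in>Basis. \<Sum>b\<in>Basis. \<Sum>c\<in>Basis. \<Sum>d\<in>Basis. p a b * D c d b * t c a d) =
        (\<Sum>b\<in>Basis. \<Sum>a\<in>Basis. \<Sum>c\<in>Basis. \<Sum>d\<in>Basis. p a b * D c d b * t c a d)"
      by (rule sum.swap)
    also have "\<dots> = (\<Sum>b\<in>Basis. \<Sum>a\<in>Basis. \<Sum>c\<in>Basis. \<Sum>d\<in>Basis. - (p b a * D c d b * t c a d))"
      by (intro sum.cong refl) (metis p_swap mult_minus_left)
    finally show ?thesis by (simp add: W_def sum_negf)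
  qed
  have W3: "(\<Sum>a\<in>Basis. \<Sum>b\<in>Basis. \<Sum>c\<in>Basis. \<Sum>d\<in>Basis. p c d * D a b d * t a b c) = W"
  proof -
    have "(\<Sum>a\<in>Basis. \<Sum>b\<in>Basis. \<Sum>c\<in>Basis. \<Sum>d\<in>Basis. p c d * D a b d * t a b c) =
        (\<Sum>c\<in>Basis. \<Sum>d\<in>Basis. \<Sum>a\<in>Basis. \<Sum>b\<in>Basis. p c d * D a b d * t a b c)"
      by (rule sum_swap_pairs)
    also have "\<dots> = (\<Sum>c\<in>Basis. \<Sum>d\<in>Basis. \<Sum>a\<in>Basis. \<Sum>b\<in>Basis. - (p c d * D a b d * t a c b))"
      by (intro sum.cong refl) (metis t_swap mult_minus_right)
    finally show ?thesis using W4 by (simp add: sum_negf)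
  qed
  have "schouten P P x [\<alpha>, \<beta>, \<gamma>] =
    (\<Sum>a\<in>Basis. \<Sum>b\<in>Basis. \<Sum>c\<in>Basis. \<Sum>d\<in>Basis.
       p a b * D c d a * t c b d - p c d * D a b c * t a b d +
       p c d * D a b d * t a b c - p a b * D c d b * t c a d) / 4"
    unfolding schouten_def schouten_decomposable_coordinate[OF diff diff]
    by (simp only: p_def D_def DP_def t_def)
  also have "\<dots> = W"
    unfolding sum.distrib sum_subtractf W2 W3 W4 by (simp add: W_def)
  finally have 1: "schouten P P x [\<alpha>, \<beta>, \<gamma>] = W" .

  \<comment> \<open>\<open>W\<close> is an alternating sum of \<open>S\<close> over the orders of the three covectors;
    in \<open>S\<close>, \<open>P\<close> is contracted with the first and its derivative with the other two\<close>
  define S where "S q r s = (\<Sum>a\<in>Basis. \<Sum>b\<in>Basis. \<Sum>c\<in>Basis. \<Sum>d\<in>Basis.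
    p a b * D c d a * (blinfun_apply q b * blinfun_apply r c * blinfun_apply s d))" for q r s
  have S: "S q r s = - DP r s (sharp (P x) q)" for q r s
  proof -
    have "S q r s = (\<Sum>a\<in>Basis. (\<Sum>b\<in>Basis. blinfun_apply q b * p a b) * DP r s a)"
      unfolding S_def sum_distrib_right DP_expand[of r s]
      by (intro sum.cong refl) (simp add: sum_distrib_left algebra_simps)
    also have "\<dots> = (\<Sum>a\<in>Basis. - P x [q, blinfun_inner_right a] * DP r s a)"
    proof (intro sum.cong refl arg_cong2[where f = "(*)"])
      fix a :: 'e
      have "(\<Sum>b\<in>Basis. blinfun_apply q b * p a b) = P x [blinfun_inner_right a, q]"
        unfolding p_def by (rule linear_covec_expand[OF alternating_2_linear(2)[OF P], symmetric])
      then show "(\<Sum>b\<in>Basis. blinfun_apply q b * p a b) = - P x [q, blinfun_inner_right a]"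
        using alternating_2_swap[OF P] by metis
    qed
    also have "\<dots> = - DP r s (sharp (P x) q)"
      unfolding sharp_eq_sum[OF P] linear_sum[OF DP_lin]
      by (simp add: linear_scale[OF DP_lin] sum_negf)
    finally show ?thesis .
  qed
  have "W = S \<beta> \<alpha> \<gamma> - S \<gamma> \<alpha> \<beta> + S \<gamma> \<beta> \<alpha> - S \<alpha> \<beta> \<gamma> + S \<alpha> \<gamma> \<beta> - S \<beta> \<gamma> \<alpha>"
    unfolding W_def S_def sum.distrib[symmetric] sum_subtractf[symmetric] t
    by (intro sum.cong refl) (simp add: algebra_simps)
  also have "\<dots> = 2 * (DP \<beta> \<gamma> (sharp (P x) \<alpha>) + DP \<gamma> \<alpha> (sharp (P x) \<beta>) + DP \<alpha> \<beta> (sharp (P x) \<gamma>))"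
    unfolding S using DP_swap[of \<alpha> \<gamma>] DP_swap[of \<beta> \<alpha>] DP_swap[of \<gamma> \<beta>] by simp
  finally show ?thesis
    using 1 by (simp add: DP_def)
qed

section \<open>Exterior and Lie derivatives on constant arguments\<close>

lemma ext_d_1:
  "ext_d 1 (\<lambda>y. alt_of_covec (\<theta> y)) x [v, w] =
    frechet_derivative (\<lambda>y. blinfun_apply (\<theta> y) w) (at x) v -
    frechet_derivative (\<lambda>y. blinfun_apply (\<theta> y) v) (at x) w"
  by (simp add: ext_d_def alt_of_covec_def)

lemma ext_d_2:
  "ext_d 2 \<eta> x [u, v, w] =
    frechet_derivative (\<lambda>y. \<eta> y [v, w]) (at x) u -
    frechet_derivative (\<lambda>y. \<eta> y [u, w]) (at x) v +
    frechet_derivative (\<lambda>y. \<eta> y [u, v]) (at x) w"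
  by (simp add: ext_d_def numeral_2_eq_2)

lemma lie_deriv_2:
  "lie_deriv 2 X P x [\<alpha>, \<beta>] =
    frechet_derivative (\<lambda>y. P y [\<alpha>, \<beta>]) (at x) (X x) -
    P x [\<alpha> o\<^sub>L Blinfun (frechet_derivative X (at x)), \<beta>] -
    P x [\<alpha>, \<beta> o\<^sub>L Blinfun (frechet_derivative X (at x))]"
  by (simp add: lie_deriv_def numeral_2_eq_2)

section \<open>Twisted contact structures in a chart\<close>

text \<open>
  The data of the theorem, read in one chart. Tensors are differentiated coefficient by coefficient,
  that is, with constant vectors and covectors as arguments.
\<close>
locale twisted_contact_chart =
  fixes U :: "'e::euclidean_space set"
    and \<theta> :: "'e \<Rightarrow> 'e covec" and \<omega> :: "'e \<Rightarrow> 'e alt"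
    and E :: "'e \<Rightarrow> 'e" and \<Lambda> :: "'e \<Rightarrow> 'e covec alt"
  assumes open_U: "open U"
    and smooth_\<theta>: "smooth_on U (\<lambda>y. blinfun_apply (\<theta> y) v)"
    and alt_\<omega>: "y \<in> U \<Longrightarrow> alternating 2 (\<omega> y)"
    and smooth_\<omega>: "smooth_on U (\<lambda>y. \<omega> y [v, w])"
    and smooth_E: "smooth_on U E"
    and alt_\<Lambda>: "y \<in> U \<Longrightarrow> alternating 2 (\<Lambda> y)"
    and smooth_\<Lambda>: "smooth_on U (\<lambda>y. \<Lambda> y [\<alpha>, \<beta>])"
    and \<theta>_E: "y \<in> U \<Longrightarrow> blinfun_apply (\<theta> y) (E y) = 1"
    and twisted_d_E: "y \<in> U \<Longrightarrow> twisted_d \<theta> \<omega> y [E y, v] = 0"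
    and sharp_\<theta>: "y \<in> U \<Longrightarrow> sharp (\<Lambda> y) (\<theta> y) = 0"
    and twisted_d_sharp: "y \<in> U \<Longrightarrow> twisted_d \<theta> \<omega> y [sharp (\<Lambda> y) \<alpha>, v] =
      - (blinfun_apply \<alpha> v - blinfun_apply \<alpha> (E y) * blinfun_apply (\<theta> y) v)"
begin

abbreviation \<Omega> :: "'e \<Rightarrow> 'e alt" where
  "\<Omega> \<equiv> twisted_d \<theta> \<omega>"

abbreviation sh :: "'e \<Rightarrow> 'e covec \<Rightarrow> 'e" where
  "sh y \<alpha> \<equiv> sharp (\<Lambda> y) \<alpha>"

abbreviation D\<theta> :: "'e \<Rightarrow> 'e \<Rightarrow> 'e \<Rightarrow> real" where
  "D\<theta> y v u \<equiv> frechet_derivative (\<lambda>z. blinfun_apply (\<theta> z) v) (at y) u"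

abbreviation D\<Omega> :: "'e \<Rightarrow> 'e \<Rightarrow> 'e \<Rightarrow> 'e \<Rightarrow> real" where
  "D\<Omega> y v w u \<equiv> frechet_derivative (\<lambda>z. \<Omega> z [v, w]) (at y) u"

abbreviation D\<Lambda> :: "'e \<Rightarrow> 'e covec \<Rightarrow> 'e covec \<Rightarrow> 'e \<Rightarrow> real" where
  "D\<Lambda> y \<alpha> \<beta> u \<equiv> frechet_derivative (\<lambda>z. \<Lambda> z [\<alpha>, \<beta>]) (at y) u"

abbreviation DE :: "'e \<Rightarrow> 'e \<Rightarrow> 'e" where
  "DE y u \<equiv> frechet_derivative E (at y) u"

lemma has_derivative_\<theta>:
  "y \<in> U \<Longrightarrow> ((\<lambda>z. blinfun_apply (\<theta> z) v) has_derivative D\<theta> y v) (at y)"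
  using smooth_on_differentiable[OF smooth_\<theta>] frechet_derivative_works by blast

lemma has_derivative_D\<theta>:
  "y \<in> U \<Longrightarrow> ((\<lambda>z. D\<theta> z v u) has_derivative frechet_derivative (\<lambda>z. D\<theta> z v u) (at y)) (at y)"
  using smooth_on_differentiable[OF smooth_on_frechet_derivative[OF smooth_\<theta>]]
    frechet_derivative_works by blast

lemma has_derivative_\<omega>:
  "y \<in> U \<Longrightarrow> ((\<lambda>z. \<omega> z [v, w]) has_derivative frechet_derivative (\<lambda>z. \<omega> z [v, w]) (at y)) (at y)"
  using smooth_on_differentiable[OF smooth_\<omega>] frechet_derivative_works by blast

lemma has_derivative_\<Lambda>:
  "y \<in> U \<Longrightarrow> ((\<lambda>z. \<Lambda> z [\<alpha>, \<beta>]) has_derivative D\<Lambda> y \<alpha> \<beta>) (at y)"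
  using smooth_on_differentiable[OF smooth_\<Lambda>] frechet_derivative_works by blast

lemma has_derivative_E: "y \<in> U \<Longrightarrow> (E has_derivative DE y) (at y)"
  using smooth_on_differentiable[OF smooth_E] frechet_derivative_works by blast

lemma \<Omega>_eq: "\<Omega> y [v, w] = D\<theta> y w v - D\<theta> y v w + \<omega> y [v, w]"
  by (simp add: twisted_d_def ext_d_1[unfolded One_nat_def])

lemma linear_D\<theta>:
  assumes "y \<in> U"
  shows "linear (\<lambda>v. D\<theta> y v u)" and "linear (D\<theta> y v)"
proof -
  show "linear (D\<theta> y v)"
    using has_derivative_\<theta>[OF assms] has_derivative_linear by blast
  show "linear (\<lambda>v. D\<theta> y v u)"
  proof
    fix a b
    have "((\<lambda>z. blinfun_apply (\<theta> z) (a + b)) has_derivative (\<lambda>u. D\<theta> y a u + D\<theta> y b u)) (at y)"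
      using has_derivative_add[OF has_derivative_\<theta>[OF assms, of a] has_derivative_\<theta>[OF assms, of b]]
      by (simp add: blinfun.add_right)
    from frechet_derivative_at[OF this] show "D\<theta> y (a + b) u = D\<theta> y a u + D\<theta> y b u"
      by metis
  next
    fix r b
    have "((\<lambda>z. blinfun_apply (\<theta> z) (r *\<^sub>R b)) has_derivative (\<lambda>u. r * D\<theta> y b u)) (at y)"
      using has_derivative_mult_right[OF has_derivative_\<theta>[OF assms, of b], of r]
      by (simp add: blinfun.scaleR_right)
    from frechet_derivative_at[OF this] show "D\<theta> y (r *\<^sub>R b) u = r *\<^sub>R D\<theta> y b u"
      by (metis real_scaleR_def)
  qed
qed

lemma \<Omega>_swap: "y \<in> U \<Longrightarrow> \<Omega> y [v, w] = - \<Omega> y [w, v]"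
  using alternating_2_swap[OF alt_\<omega>, of y v w] by (simp add: \<Omega>_eq)

lemma linear_\<Omega>: "y \<in> U \<Longrightarrow> linear (\<lambda>v. \<Omega> y [v, w])"
  unfolding \<Omega>_eq
  by (intro linear_compose_add linear_compose_sub linear_D\<theta> alternating_2_linear alt_\<omega>)

lemma has_derivative_\<Omega>:
  assumes "y \<in> U"
  shows "((\<lambda>z. \<Omega> z [v, w]) has_derivative
    (\<lambda>u. frechet_derivative (\<lambda>z. D\<theta> z w v) (at y) u - frechet_derivative (\<lambda>z. D\<theta> z v w) (at y) u +
      frechet_derivative (\<lambda>z. \<omega> z [v, w]) (at y) u)) (at y)"
  unfolding \<Omega>_eq
  by (intro has_derivative_add has_derivative_diff has_derivative_D\<theta> has_derivative_\<omega> assms)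

lemma differentiable_\<Omega>: "y \<in> U \<Longrightarrow> (\<lambda>z. \<Omega> z [v, w]) differentiable (at y)"
  using has_derivative_\<Omega> differentiable_def by blast

lemma D\<Omega>_swap:
  assumes "x \<in> U"
  shows "D\<Omega> x v w u = - D\<Omega> x w v u"
proof -
  have "((\<lambda>z. \<Omega> z [w, v]) has_derivative D\<Omega> x w v) (at x)"
    using differentiable_\<Omega>[OF assms] frechet_derivative_works by blast
  from has_derivative_transform_within_open[OF has_derivative_minus[OF this] open_U assms]
  have "((\<lambda>z. \<Omega> z [v, w]) has_derivative (\<lambda>u. - D\<Omega> x w v u)) (at x)"
    using \<Omega>_swap by metis
  from frechet_derivative_at[OF this] show ?thesis by metis
qed

lemma second_derivative_\<theta>_commute:
  assumes "x \<in> U"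
  shows "frechet_derivative (\<lambda>z. D\<theta> z v u) (at x) w = frechet_derivative (\<lambda>z. D\<theta> z v w) (at x) u"
proof (rule second_derivative_commute[OF open_U assms])
  show "(\<lambda>z. blinfun_apply (\<theta> z) v) differentiable (at y)" if "y \<in> U" for y
    using smooth_on_differentiable[OF smooth_\<theta> that] .
  show "(\<lambda>z. D\<theta> z v u) differentiable (at y)" if "y \<in> U" for y u
    using smooth_on_differentiable[OF smooth_on_frechet_derivative[OF smooth_\<theta>] that] .
  show "continuous_on U (\<lambda>y. frechet_derivative (\<lambda>z. D\<theta> z v u) (at y) w)" for u w
    by (intro smooth_on_continuous_on smooth_on_frechet_derivative smooth_\<theta>)
qed

text \<open>
  The left-hand side is the exterior derivative of \<open>\<Omega> = d\<theta> + \<omega>\<close>, and \<open>d (d\<theta>) = 0\<close> because mixed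
  derivatives commute.
\<close>
lemma d_\<Omega>_eq_d_\<omega>:
  assumes "x \<in> U"
  shows "D\<Omega> x v w u + D\<Omega> x w u v + D\<Omega> x u v w = ext_d 2 \<omega> x [u, v, w]"
proof -
  have D: "D\<Omega> x v w u = frechet_derivative (\<lambda>z. D\<theta> z w v) (at x) u -
      frechet_derivative (\<lambda>z. D\<theta> z v w) (at x) u + frechet_derivative (\<lambda>z. \<omega> z [v, w]) (at x) u" for v w u
    by (rule fun_cong[OF frechet_derivative_at[OF has_derivative_\<Omega>[OF assms], symmetric]])
  have "((\<lambda>z. \<omega> z [w, u]) has_derivative (\<lambda>h. - frechet_derivative (\<lambda>z. \<omega> z [u, w]) (at x) h)) (at x)"
    by (rule has_derivative_transform_within_open[OF
          has_derivative_minus[OF has_derivative_\<omega>[OF assms]] open_U assms])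
      (rule alternating_2_swap[OF alt_\<omega>, symmetric])
  from fun_cong[OF frechet_derivative_at[OF this, symmetric], of v]
  have "frechet_derivative (\<lambda>z. \<omega> z [w, u]) (at x) v = - frechet_derivative (\<lambda>z. \<omega> z [u, w]) (at x) v" .
  then show ?thesis
    unfolding ext_d_2 D
    using second_derivative_\<theta>_commute[OF assms, of u v w] second_derivative_\<theta>_commute[OF assms, of v u w]
      second_derivative_\<theta>_commute[OF assms, of w u v]
    by simp
qed

lemma apply_sh: "y \<in> U \<Longrightarrow> blinfun_apply \<beta> (sh y \<alpha>) = \<Lambda> y [\<alpha>, \<beta>]"
  by (intro apply_sharp alt_\<Lambda>)

lemma \<Lambda>_swap: "y \<in> U \<Longrightarrow> \<Lambda> y [\<alpha>, \<beta>] = - \<Lambda> y [\<beta>, \<alpha>]"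
  by (intro alternating_2_swap alt_\<Lambda>)

text \<open>
  Hamiltonian vectors lie in the kernel of \<open>\<theta>\<close>: since \<open>\<Lambda>\<close> is antisymmetric, this is the assumption
  that \<open>\<theta>\<close> itself has no Hamiltonian vector.
\<close>
lemma \<theta>_sh: "y \<in> U \<Longrightarrow> blinfun_apply (\<theta> y) (sh y \<alpha>) = 0"
  using apply_sh[of y "\<theta> y" \<alpha>] apply_sh[of y \<alpha> "\<theta> y"] \<Lambda>_swap[of y \<alpha> "\<theta> y"]
  by (simp add: sharp_\<theta> blinfun.zero_right)

lemma \<Omega>_sh: "y \<in> U \<Longrightarrow> \<Omega> y [v, sh y \<alpha>] =
    blinfun_apply \<alpha> v - blinfun_apply \<alpha> (E y) * blinfun_apply (\<theta> y) v"
  using \<Omega>_swap[of y v "sh y \<alpha>"] twisted_d_sharp[of y \<alpha> v] by simp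

lemma \<Omega>_sh_sh:
  assumes "y \<in> U"
  shows "\<Omega> y [sh y \<alpha>, sh y \<beta>] = \<Lambda> y [\<alpha>, \<beta>]"
  using assms \<Omega>_sh[of y "sh y \<alpha>" \<beta>] \<theta>_sh[of y \<alpha>] apply_sh[of y \<beta> \<alpha>] by simp

lemma differentiable_sh:
  assumes "x \<in> U"
  shows "(\<lambda>y. sh y \<alpha>) differentiable (at x)"
proof -
  have "((\<lambda>y. \<Sum>e\<in>Basis. \<Lambda> y [\<alpha>, blinfun_inner_right e] *\<^sub>R e) has_derivative
      (\<lambda>u. \<Sum>e\<in>Basis. D\<Lambda> x \<alpha> (blinfun_inner_right e) u *\<^sub>R e)) (at x)"
    by (intro has_derivative_sum has_derivative_scaleR_left has_derivative_\<Lambda> assms)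
  from has_derivative_transform_within_open[OF this open_U assms
      sharp_eq_sum[OF alt_\<Lambda>, symmetric]]
  show ?thesis
    unfolding differentiable_def by blast
qed

text \<open>
  This lemma turns derivatives of \<open>\<Lambda>\<close> into derivatives of \<open>\<Omega>\<close>; both parts of the theorem follow from
  it, the first with \<open>u\<close> a Hamiltonian vector, the second with \<open>u = E\<close>. The relation
  \<open>\<Omega> y [sh y \<alpha>, v] = - (\<alpha> v - \<alpha> (E y) * \<theta> y v)\<close> that defines \<open>\<Lambda>\<close> is differentiated for a constant \<open>v\<close>,
  and only then is \<open>v = sh x \<beta>\<close> substituted: the derivative of \<open>E\<close> gets the coefficient
  \<open>\<theta> x (sh x \<beta>) = 0\<close> and disappears. The derivative \<open>S\<close> of \<open>sh y \<alpha>\<close> also disappears, since the same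
  relation, now for \<open>\<beta>\<close>, expresses \<open>\<Omega> x [S, sh x \<beta>]\<close> by \<open>\<beta> S\<close> and \<open>\<theta> x S\<close>. These are known by
  differentiating \<open>\<beta> (sh y \<alpha>) = \<Lambda> y [\<alpha>, \<beta>]\<close> and \<open>\<theta> y (sh y \<alpha>) = 0\<close>.
\<close>
lemma D\<Omega>_sh_sh:
  assumes x: "x \<in> U"
  shows "D\<Omega> x (sh x \<alpha>) (sh x \<beta>) u + D\<Lambda> x \<alpha> \<beta> u =
    blinfun_apply \<alpha> (E x) * D\<theta> x (sh x \<beta>) u - blinfun_apply \<beta> (E x) * D\<theta> x (sh x \<alpha>) u"
proof -
  note sh_diff = differentiable_sh[OF x]
  define S where "S = frechet_derivative (\<lambda>y. sh y \<alpha>) (at x) u"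
  have S: "((\<lambda>y. sh y \<alpha>) has_derivative frechet_derivative (\<lambda>y. sh y \<alpha>) (at x)) (at x)"
    using sh_diff frechet_derivative_works by blast
  have "((\<lambda>y. \<Lambda> y [\<alpha>, \<beta>]) has_derivative
      (\<lambda>u. blinfun_apply \<beta> (frechet_derivative (\<lambda>y. sh y \<alpha>) (at x) u))) (at x)"
    by (rule has_derivative_transform_within_open[OF
          bounded_linear.has_derivative[OF blinfun.bounded_linear_right S] open_U x])
      (rule apply_sh)
  from fun_cong[OF frechet_derivative_at[OF this], of u]
  have \<beta>S: "blinfun_apply \<beta> S = D\<Lambda> x \<alpha> \<beta> u"
    unfolding S_def .
  have "((\<lambda>y. 0) has_derivative (\<lambda>u. D\<theta> x (sh x \<alpha>) u +
      blinfun_apply (\<theta> x) (frechet_derivative (\<lambda>y. sh y \<alpha>) (at x) u))) (at x)"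
    by (rule has_derivative_transform_within_open[OF
          has_derivative_pairing[where L = "\<lambda>y. blinfun_apply (\<theta> y)", OF open_U x _
            smooth_on_differentiable[OF smooth_\<theta> x] sh_diff] open_U x])
      (auto simp: \<theta>_sh bounded_linear.linear blinfun.bounded_linear_right)
  from fun_cong[OF has_derivative_unique[OF this has_derivative_const], of u]
  have \<theta>S: "D\<theta> x (sh x \<alpha>) u + blinfun_apply (\<theta> x) S = 0"
    unfolding S_def .
  have 1: "((\<lambda>y. - (blinfun_apply \<alpha> (sh x \<beta>) - blinfun_apply \<alpha> (E y) * blinfun_apply (\<theta> y) (sh x \<beta>)))
      has_derivative (\<lambda>u. D\<Omega> x (sh x \<alpha>) (sh x \<beta>) u +
        \<Omega> x [frechet_derivative (\<lambda>y. sh y \<alpha>) (at x) u, sh x \<beta>])) (at x)"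
    by (rule has_derivative_transform_within_open[OF
          has_derivative_pairing[where L = "\<lambda>y v. \<Omega> y [v, sh x \<beta>]", OF open_U x linear_\<Omega>
            differentiable_\<Omega>[OF x] sh_diff] open_U x])
      (auto simp: twisted_d_sharp)
  have 2: "((\<lambda>y. - (blinfun_apply \<alpha> (sh x \<beta>) - blinfun_apply \<alpha> (E y) * blinfun_apply (\<theta> y) (sh x \<beta>)))
      has_derivative (\<lambda>u. - (0 - (blinfun_apply \<alpha> (E x) * D\<theta> x (sh x \<beta>) u +
        blinfun_apply \<alpha> (DE x u) * blinfun_apply (\<theta> x) (sh x \<beta>))))) (at x)"
    by (intro has_derivative_minus has_derivative_diff has_derivative_const has_derivative_mult
        bounded_linear.has_derivative[OF blinfun.bounded_linear_right] has_derivative_E has_derivative_\<theta> x)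
  from fun_cong[OF has_derivative_unique[OF 1 2], of u]
  have "D\<Omega> x (sh x \<alpha>) (sh x \<beta>) u + \<Omega> x [S, sh x \<beta>] =
      - (0 - (blinfun_apply \<alpha> (E x) * D\<theta> x (sh x \<beta>) u +
        blinfun_apply \<alpha> (DE x u) * blinfun_apply (\<theta> x) (sh x \<beta>)))"
    unfolding S_def .
  moreover have "blinfun_apply (\<theta> x) S = - D\<theta> x (sh x \<alpha>) u"
    using \<theta>S by simp
  ultimately show ?thesis
    by (simp add: \<Omega>_sh \<theta>_sh \<beta>S x)
qed

text \<open>
  The equation \<open>\<Omega> y [E y, v] = 0\<close>, differentiated. Likewise \<open>\<theta> y (E y) = 1\<close> in the next lemma.
\<close>
lemma D\<Omega>_E:
  assumes x: "x \<in> U"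
  shows "D\<Omega> x (E x) v u + \<Omega> x [DE x u, v] = 0"
proof -
  have "((\<lambda>y. 0) has_derivative (\<lambda>u. D\<Omega> x (E x) v u + \<Omega> x [DE x u, v])) (at x)"
    by (rule has_derivative_transform_within_open[OF
          has_derivative_pairing[where L = "\<lambda>y w. \<Omega> y [w, v]", OF open_U x linear_\<Omega>
            differentiable_\<Omega>[OF x] smooth_on_differentiable[OF smooth_E x]] open_U x])
      (auto simp: twisted_d_E)
  from fun_cong[OF has_derivative_unique[OF this has_derivative_const], of u] show ?thesis .
qed

lemma D\<theta>_E:
  assumes x: "x \<in> U"
  shows "D\<theta> x (E x) u = - blinfun_apply (\<theta> x) (DE x u)"
proof -
  have "((\<lambda>y. 1) has_derivative (\<lambda>u. D\<theta> x (E x) u + blinfun_apply (\<theta> x) (DE x u))) (at x)"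
    by (rule has_derivative_transform_within_open[OF
          has_derivative_pairing[where L = "\<lambda>y. blinfun_apply (\<theta> y)", OF open_U x _
            smooth_on_differentiable[OF smooth_\<theta> x] smooth_on_differentiable[OF smooth_E x]] open_U x])
      (auto simp: \<theta>_E bounded_linear.linear blinfun.bounded_linear_right)
  from fun_cong[OF has_derivative_unique[OF this has_derivative_const], of u]
  have "D\<theta> x (E x) u + blinfun_apply (\<theta> x) (DE x u) = 0" .
  then show ?thesis by simp
qed

text \<open>
  The cyclic sum of \<open>D\<Omega>_sh_sh\<close> over the three covectors. The derivatives of \<open>\<Omega>\<close> add up to \<open>d\<omega>\<close>, and
  the derivatives of \<open>\<theta>\<close> combine in pairs to values of \<open>d\<theta> = \<Omega> - \<omega>\<close> on Hamiltonian vectors. There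
  \<open>\<Omega>\<close> is \<open>\<Lambda>\<close>, which yields the term with \<open>E \<and> \<Lambda>\<close>, and \<open>\<omega>\<close> yields the last term.
\<close>
lemma schouten_\<Lambda>_\<Lambda>:
  assumes x: "x \<in> U"
  shows "schouten \<Lambda> \<Lambda> x [\<alpha>, \<beta>, \<gamma>] + 2 * wedge 1 2 (alt_of_vec (E x)) (\<Lambda> x) [\<alpha>, \<beta>, \<gamma>] =
    2 * sharp_form 3 (\<Lambda> x) (ext_d 2 \<omega> x) [\<alpha>, \<beta>, \<gamma>] +
    2 * wedge 2 1 (sharp_form 2 (\<Lambda> x) (\<omega> x)) (alt_of_vec (E x)) [\<alpha>, \<beta>, \<gamma>]"
proof -
  have s: "schouten \<Lambda> \<Lambda> x [\<alpha>, \<beta>, \<gamma>] =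
      2 * (D\<Lambda> x \<beta> \<gamma> (sh x \<alpha>) + D\<Lambda> x \<gamma> \<alpha> (sh x \<beta>) + D\<Lambda> x \<alpha> \<beta> (sh x \<gamma>))"
    by (rule schouten_self[OF open_U x alt_\<Lambda> smooth_on_differentiable[OF smooth_\<Lambda> x]])
  have w1: "wedge 1 2 (alt_of_vec (E x)) (\<Lambda> x) [\<alpha>, \<beta>, \<gamma>] =
      blinfun_apply \<alpha> (E x) * \<Lambda> x [\<beta>, \<gamma>] + blinfun_apply \<beta> (E x) * \<Lambda> x [\<gamma>, \<alpha>] +
      blinfun_apply \<gamma> (E x) * \<Lambda> x [\<alpha>, \<beta>]"
    by (subst wedge_1_2) (auto simp: alt_of_vec_def intro: \<Lambda>_swap[OF x])
  have w2: "wedge 2 1 (sharp_form 2 (\<Lambda> x) (\<omega> x)) (alt_of_vec (E x)) [\<alpha>, \<beta>, \<gamma>] =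
      \<omega> x [sh x \<alpha>, sh x \<beta>] * blinfun_apply \<gamma> (E x) + \<omega> x [sh x \<beta>, sh x \<gamma>] * blinfun_apply \<alpha> (E x) +
      \<omega> x [sh x \<gamma>, sh x \<alpha>] * blinfun_apply \<beta> (E x)"
    by (subst wedge_2_1) (auto simp: alt_of_vec_def sharp_form_def intro: alternating_2_swap[OF alt_\<omega>[OF x]])
  have "D\<Lambda> x \<beta> \<gamma> (sh x \<alpha>) + D\<Lambda> x \<gamma> \<alpha> (sh x \<beta>) + D\<Lambda> x \<alpha> \<beta> (sh x \<gamma>) =
      - ext_d 2 \<omega> x [sh x \<alpha>, sh x \<beta>, sh x \<gamma>]
      - blinfun_apply \<gamma> (E x) * (D\<theta> x (sh x \<beta>) (sh x \<alpha>) - D\<theta> x (sh x \<alpha>) (sh x \<beta>))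
      - blinfun_apply \<alpha> (E x) * (D\<theta> x (sh x \<gamma>) (sh x \<beta>) - D\<theta> x (sh x \<beta>) (sh x \<gamma>))
      - blinfun_apply \<beta> (E x) * (D\<theta> x (sh x \<alpha>) (sh x \<gamma>) - D\<theta> x (sh x \<gamma>) (sh x \<alpha>))"
    unfolding d_\<Omega>_eq_d_\<omega>[OF x, symmetric]
    using D\<Omega>_sh_sh[OF x, of \<beta> \<gamma> "sh x \<alpha>"] D\<Omega>_sh_sh[OF x, of \<gamma> \<alpha> "sh x \<beta>"] D\<Omega>_sh_sh[OF x, of \<alpha> \<beta> "sh x \<gamma>"]
    by (simp add: algebra_simps)
  moreover have d\<theta>: "D\<theta> x (sh x \<eta>) (sh x \<xi>) - D\<theta> x (sh x \<xi>) (sh x \<eta>) =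
      \<Lambda> x [\<xi>, \<eta>] - \<omega> x [sh x \<xi>, sh x \<eta>]" for \<xi> \<eta>
    using \<Omega>_eq[of x "sh x \<xi>" "sh x \<eta>"] \<Omega>_sh_sh[OF x] by simp
  ultimately show ?thesis
    unfolding s w1 w2 d\<theta> by (simp add: sharp_form_def algebra_simps)
qed

text \<open>
  The same argument with \<open>E\<close> as third vector. In \<open>d\<omega>\<close>, the two terms that differentiate along
  Hamiltonian vectors involve \<open>\<Omega>\<close> with \<open>E\<close> in one slot, so they are given by the derivative of \<open>E\<close>;
  these are the terms by which the Lie derivative of \<open>\<Lambda>\<close> differs from the derivative of its
  coefficients. As \<open>\<Omega>\<close> vanishes on \<open>E\<close>, only \<open>- \<omega>\<close> survives from \<open>d\<theta> = \<Omega> - \<omega>\<close>.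
\<close>
lemma lie_deriv_E_\<Lambda>:
  assumes x: "x \<in> U"
  shows "lie_deriv 2 E \<Lambda> x [\<alpha>, \<beta>] =
    sharp_form_vec 3 (\<Lambda> x) (ext_d 2 \<omega> x) (E x) [\<alpha>, \<beta>] -
    wedge 1 1 (sharp_form_vec 2 (\<Lambda> x) (\<omega> x) (E x)) (alt_of_vec (E x)) [\<alpha>, \<beta>]"
proof -
  let ?B = "Blinfun (frechet_derivative E (at x))"
  have B: "blinfun_apply (\<xi> o\<^sub>L ?B) v = blinfun_apply \<xi> (DE x v)" for \<xi> :: "'e covec" and v
    using has_derivative_bounded_linear[OF has_derivative_E[OF x]]
    by (simp add: bounded_linear_Blinfun_apply)
  have \<alpha>B: "\<Lambda> x [\<alpha> o\<^sub>L ?B, \<beta>] = - blinfun_apply \<alpha> (DE x (sh x \<beta>))"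
    using \<Lambda>_swap[OF x, of "\<alpha> o\<^sub>L ?B" \<beta>] apply_sh[OF x, of "\<alpha> o\<^sub>L ?B" \<beta>] B by metis
  have \<beta>B: "\<Lambda> x [\<alpha>, \<beta> o\<^sub>L ?B] = blinfun_apply \<beta> (DE x (sh x \<alpha>))"
    using apply_sh[OF x, of "\<beta> o\<^sub>L ?B" \<alpha>] B by metis
  have l: "lie_deriv 2 E \<Lambda> x [\<alpha>, \<beta>] =
      D\<Lambda> x \<alpha> \<beta> (E x) + blinfun_apply \<alpha> (DE x (sh x \<beta>)) - blinfun_apply \<beta> (DE x (sh x \<alpha>))"
    unfolding lie_deriv_2 \<alpha>B \<beta>B by simp
  have DE_\<Omega>: "D\<Omega> x (E x) (sh x \<xi>) u =
      - blinfun_apply \<xi> (DE x u) - blinfun_apply \<xi> (E x) * D\<theta> x (E x) u" for \<xi> u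
    using D\<Omega>_E[OF x, of "sh x \<xi>" u] by (simp add: \<Omega>_sh D\<theta>_E x)
  have d\<theta>: "D\<theta> x (E x) (sh x \<xi>) = D\<theta> x (sh x \<xi>) (E x) - \<omega> x [sh x \<xi>, E x]" for \<xi>
    using \<Omega>_eq[of x "sh x \<xi>" "E x"] \<Omega>_swap[OF x, of "sh x \<xi>" "E x"] twisted_d_E[OF x] by simp
  have "ext_d 2 \<omega> x [sh x \<alpha>, sh x \<beta>, E x] =
      D\<Omega> x (sh x \<beta>) (E x) (sh x \<alpha>) + D\<Omega> x (E x) (sh x \<alpha>) (sh x \<beta>) + D\<Omega> x (sh x \<alpha>) (sh x \<beta>) (E x)"
    by (rule d_\<Omega>_eq_d_\<omega>[OF x, symmetric])
  also have "\<dots> = - (lie_deriv 2 E \<Lambda> x [\<alpha>, \<beta>] + blinfun_apply \<beta> (E x) * \<omega> x [sh x \<alpha>, E x] -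
      blinfun_apply \<alpha> (E x) * \<omega> x [sh x \<beta>, E x])"
    using D\<Omega>_sh_sh[OF x, of \<alpha> \<beta> "E x"] D\<Omega>_swap[OF x, of "sh x \<beta>" "E x" "sh x \<alpha>"]
    by (simp add: DE_\<Omega> d\<theta> l algebra_simps)
  finally show ?thesis
    unfolding wedge_1_1 by (simp add: sharp_form_vec_def alt_of_vec_def algebra_simps)
qed

end

section \<open>Twisted contact manifolds are twisted Jacobi\<close>

lemma twisted_contact_chart_of_manifold:
  assumes contact: "twisted_contact_manifold n A \<theta> \<omega>"
    and E: "vector_field A E"
    and \<theta>_E: "\<And>x. x \<in> chart_image c \<Longrightarrow> blinfun_apply (\<theta> c x) (E c x) = 1"
    and d_E: "\<And>x v. x \<in> chart_image c \<Longrightarrow> int_prod (E c x) (twisted_d (\<theta> c) (\<omega> c) x) [v] = 0"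
    and \<Lambda>: "multivector_field A 2 \<Lambda>"
    and sharp_\<theta>: "\<And>x. x \<in> chart_image c \<Longrightarrow> sharp (\<Lambda> c x) (\<theta> c x) = 0"
    and d_sharp: "\<And>x \<alpha> v. x \<in> chart_image c \<Longrightarrow>
      int_prod (sharp (\<Lambda> c x) \<alpha>) (twisted_d (\<theta> c) (\<omega> c) x) [v] =
      - blinfun_apply (\<alpha> - blinfun_apply \<alpha> (E c x) *\<^sub>R \<theta> c x) v"
    and c: "c \<in> A"
  shows "twisted_contact_chart (chart_image c) (\<theta> c) (\<omega> c) (E c) (\<Lambda> c)"
proof
  have A: "smooth_atlas A" and \<theta>: "form_field A 1 (\<lambda>c x. alt_of_covec (\<theta> c x))"
    and \<omega>: "form_field A 2 \<omega>"
    using contact by (simp_all add: twisted_contact_manifold_def one_form_def)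
  show "open (chart_image c)"
    using A c by (simp add: smooth_atlas_def)
  show "smooth_on (chart_image c) (\<lambda>y. blinfun_apply (\<theta> c y) v)" for v
  proof -
    have "smooth_on (chart_image c) (\<lambda>x. alt_of_covec (\<theta> c x) [v])"
      using \<theta> c unfolding form_field_def by simp
    then show ?thesis by (simp add: alt_of_covec_def)
  qed
  show "alternating 2 (\<omega> c y)" if "y \<in> chart_image c" for y
    using \<omega> c that by (simp add: form_field_def)
  show "smooth_on (chart_image c) (\<lambda>y. \<omega> c y [v, w])" for v w
    using \<omega> c by (simp add: form_field_def)
  show "smooth_on (chart_image c) (E c)"
    using E c by (simp add: vector_field_def)
  show "alternating 2 (\<Lambda> c y)" if "y \<in> chart_image c" for y
    using \<Lambda> c that by (simp add: multivector_field_def)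
  show "smooth_on (chart_image c) (\<lambda>y. \<Lambda> c y [\<alpha>, \<beta>])" for \<alpha> \<beta>
    using \<Lambda> c by (simp add: multivector_field_def)
  show "twisted_d (\<theta> c) (\<omega> c) y [E c y, v] = 0" if "y \<in> chart_image c" for y v
    using d_E[OF that] by (simp add: int_prod_def)
  show "twisted_d (\<theta> c) (\<omega> c) y [sharp (\<Lambda> c y) \<alpha>, v] =
      - (blinfun_apply \<alpha> v - blinfun_apply \<alpha> (E c y) * blinfun_apply (\<theta> c y) v)"
    if "y \<in> chart_image c" for y \<alpha> v
    using d_sharp[OF that] by (simp add: int_prod_def blinfun.bilinear_simps)
qed (simp_all add: \<theta>_E sharp_\<theta>)

theorem mainTheorem4:
  fixes A :: "('m::{t2_space,second_countable_topology}, 'e::euclidean_space) chart set"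
    and n :: nat
    and \<theta> :: "('m, 'e) chart \<Rightarrow> 'e \<Rightarrow> 'e covec"
    and \<omega> :: "('m, 'e) chart \<Rightarrow> 'e \<Rightarrow> 'e alt"
    and E :: "('m, 'e) chart \<Rightarrow> 'e \<Rightarrow> 'e"
    and \<Lambda> :: "('m, 'e) chart \<Rightarrow> 'e \<Rightarrow> 'e covec alt"
  assumes "twisted_contact_manifold n A \<theta> \<omega>"
    and "vector_field A E"
    and "\<And>c x. c \<in> A \<Longrightarrow> x \<in> chart_image c \<Longrightarrow> blinfun_apply (\<theta> c x) (E c x) = 1"
    and "\<And>c x v. c \<in> A \<Longrightarrow> x \<in> chart_image c \<Longrightarrow>
           int_prod (E c x) (twisted_d (\<theta> c) (\<omega> c) x) [v] = 0"
    and "multivector_field A 2 \<Lambda>"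
    and "\<And>c x. c \<in> A \<Longrightarrow> x \<in> chart_image c \<Longrightarrow> sharp (\<Lambda> c x) (\<theta> c x) = 0"
    and "\<And>c x \<alpha> v. c \<in> A \<Longrightarrow> x \<in> chart_image c \<Longrightarrow>
           int_prod (sharp (\<Lambda> c x) \<alpha>) (twisted_d (\<theta> c) (\<omega> c) x) [v] =
           - blinfun_apply (\<alpha> - blinfun_apply \<alpha> (E c x) *\<^sub>R \<theta> c x) v"
  shows "twisted_jacobi A \<Lambda> E \<omega>"
proof -
  have chart: "twisted_contact_chart (chart_image c) (\<theta> c) (\<omega> c) (E c) (\<Lambda> c)" if "c \<in> A" for c
    by (rule twisted_contact_chart_of_manifold[OF assms(1,2) assms(3,4)[OF that] assms(5)
          assms(6,7)[OF that] that])
  have list3: "\<exists>\<alpha> \<beta> \<gamma>. as = [\<alpha>, \<beta>, \<gamma>]" if "length as = 3" for as :: "'e covec list"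
    using that by (auto simp: numeral_3_eq_3 length_Suc_conv)
  have list2: "\<exists>\<alpha> \<beta>. as = [\<alpha>, \<beta>]" if "length as = 2" for as :: "'e covec list"
    using that by (auto simp: numeral_2_eq_2 length_Suc_conv)
  show ?thesis
    unfolding twisted_jacobi_def
  proof (intro conjI ballI allI impI)
    show "smooth_atlas A" "form_field A 2 \<omega>"
      using assms(1) by (simp_all add: twisted_contact_manifold_def)
  next
    fix c x and as :: "'e covec list"
    assume c: "c \<in> A" and x: "x \<in> chart_image c" and "length as = 3"
    then obtain \<alpha> \<beta> \<gamma> where as: "as = [\<alpha>, \<beta>, \<gamma>]" using list3 by blast
    show "schouten (\<Lambda> c) (\<Lambda> c) x as + 2 * wedge 1 2 (alt_of_vec (E c x)) (\<Lambda> c x) as =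
        2 * sharp_form 3 (\<Lambda> c x) (ext_d 2 (\<omega> c) x) as +
        2 * wedge 2 1 (sharp_form 2 (\<Lambda> c x) (\<omega> c x)) (alt_of_vec (E c x)) as"
      unfolding as by (rule twisted_contact_chart.schouten_\<Lambda>_\<Lambda>[OF chart[OF c] x])
  next
    fix c x and as :: "'e covec list"
    assume c: "c \<in> A" and x: "x \<in> chart_image c" and "length as = 2"
    then obtain \<alpha> \<beta> where as: "as = [\<alpha>, \<beta>]" using list2 by blast
    show "lie_deriv 2 (E c) (\<Lambda> c) x as =
        sharp_form_vec 3 (\<Lambda> c x) (ext_d 2 (\<omega> c) x) (E c x) as -
        wedge 1 1 (sharp_form_vec 2 (\<Lambda> c x) (\<omega> c x) (E c x)) (alt_of_vec (E c x)) as"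
      unfolding as by (rule twisted_contact_chart.lie_deriv_E_\<Lambda>[OF chart[OF c] x])
  qed (fact assms)+
qed

end
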